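(* Let $T$ be a 1-point lattice tetrahedron with $\mathrm{vol}(T)=n/6$ and interior lattice point $w$, and suppose that, up to a permutation of coordinates, the barycentric coordinates of $w$ with respect to $T$ equal one of $\lambda^{(1)}=(\tfrac14,\tfrac14,\tfrac14,\tfrac14)$, $\lambda^{(2)}=(\tfrac15,\tfrac15,\tfrac15,\tfrac25)$, $\lambda^{(3)}=(\tfrac17,\tfrac17,\tfrac27,\tfrac37)$, $\lambda^{(4)}=(\tfrac2{11},\tfrac1{11},\tfrac3{11},\tfrac5{11})$, $\lambda^{(5)}=(\tfrac1{13},\tfrac3{13},\tfrac4{13},\tfrac5{13})$, $\lambda^{(6)}=(\tfrac2{17},\tfrac3{17},\tfrac5{17},\tfrac7{17})$, $\lambda^{(7)}=(\tfrac3{19},\tfrac5{19},\tfrac4{19},\tfrac7{19})$, say to $\lambda^{(\ell)}$, whose entries have common denominator $N$ (namely $N=4,5,7,11,13,17,19$ respectively). Let $g=n/N$. If $g>1$, then $\ell=1$, $g=5$, and $T$ is equivalent to $T_{3,7,20}$, which is equivalent to $T_{3,11,20}$ and to $T_{7,11,20}$.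
   Context: A lattice tetrahedron is a non-degenerate tetrahedron with vertices in $\mathbb{Z}^3$; it is clean if the only lattice points on its boundary are its vertices, and a 1-point lattice tetrahedron if it is clean with exactly one interior lattice point. Barycentric coordinates of $w$ with respect to $T=\mathrm{conv}(v_1,\dots,v_4)$ are the reals $\lambda_j$ with $w=\sum\lambda_jv_j$, $\sum\lambda_j=1$. For $(a,b,n)\in\mathbb{Z}^3$, $n\ne0$, $T_{a,b,n}$ is the tetrahedron with vertices $(0,0,0),(1,0,0),(0,1,0),(a,b,n)$. Two lattice tetrahedra are equivalent if some map $v\mapsto Mv+u$ with $M\in M_3(\mathbb{Z})$, $\det M=\pm1$, $u\in\mathbb{Z}^3$ maps the vertex set of one onto the vertex set of the other (in any order). *)

theory Defs
  imports "HOL-Analysis.Analysis" "HOL-Library.Multiset"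
begin

definition int_lattice :: "(real^3) set" where
  "int_lattice = {x. \<forall>i. x $ i \<in> \<int>}"

definition vertices :: "(real^3) set \<Rightarrow> (real^3) set" where
  "vertices T = {x. x extreme_point_of T}"

definition lattice_tetrahedron :: "(real^3) set \<Rightarrow> bool" where
  "lattice_tetrahedron T \<longleftrightarrow> 3 simplex T \<and> vertices T \<subseteq> int_lattice"

definition clean :: "(real^3) set \<Rightarrow> bool" where
  "clean T \<longleftrightarrow> frontier T \<inter> int_lattice = vertices T"

definition one_point_lattice_tetrahedron :: "(real^3) set \<Rightarrow> bool" where
  "one_point_lattice_tetrahedron T \<longleftrightarrow>
     lattice_tetrahedron T \<and> clean T \<and> card (interior T \<inter> int_lattice) = 1"

definition barycentric_coords :: "(real^3) list \<Rightarrow> real^3 \<Rightarrow> real list \<Rightarrow> bool" where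
  "barycentric_coords vs w \<mu> \<longleftrightarrow>
     length \<mu> = length vs \<and>
     w = (\<Sum>j<length vs. \<mu> ! j *\<^sub>R vs ! j) \<and>
     (\<Sum>j<length vs. \<mu> ! j) = 1"

definition T_abn :: "int \<Rightarrow> int \<Rightarrow> int \<Rightarrow> (real^3) set" where
  "T_abn a b n = convex hull
     {vector [0, 0, 0], vector [1, 0, 0], vector [0, 1, 0],
      vector [of_int a, of_int b, of_int n]}"

definition equivalent :: "(real^3) set \<Rightarrow> (real^3) set \<Rightarrow> bool" where
  "equivalent S T \<longleftrightarrow>
     lattice_tetrahedron S \<and> lattice_tetrahedron T \<and>
     (\<exists>(M :: real^3^3) u.
        (\<forall>i j. M $ i $ j \<in> \<int>) \<and> (det M = 1 \<or> det M = -1) \<and> u \<in> int_lattice \<and>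
        (\<lambda>v. M *v v + u) ` vertices S = vertices T)"

text \<open>Both functions below are indexed by \<open>{1..7}\<close>; their values elsewhere are not used.\<close>

definition bary_tuple :: "nat \<Rightarrow> real list" where
  "bary_tuple l =
     [[1/4, 1/4, 1/4, 1/4],
      [1/5, 1/5, 1/5, 2/5],
      [1/7, 1/7, 2/7, 3/7],
      [2/11, 1/11, 3/11, 5/11],
      [1/13, 3/13, 4/13, 5/13],
      [2/17, 3/17, 5/17, 7/17],
      [3/19, 5/19, 4/19, 7/19]] ! (l - 1)"

definition bary_denom :: "nat \<Rightarrow> nat" where
  "bary_denom l = [4, 5, 7, 11, 13, 17, 19] ! (l - 1)"

end

(* Cleanness forces the face opposite v0 to be an empty, hence unimodular, triangle, so T may be taken
   to be T_{a,b,n} with v0 the vertex (a,b,n).  The lattice point (0,0,k) then has barycentric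
   coordinates k A_i / n modulo 1, where A = (1, a+b-1, -a, -b).  If the residues of the k A_i modulo n
   add up to n, they give a lattice point of T, which must be w; the case 3n is the same for -k.
   Hence they add up to 2n whenever k is not a multiple of g.

   Moving k by g c_0 adds w to the point, so each residue grows by g c_i and, the sum staying 2n and the
   c_i adding up to N, exactly one of the four residues passes n.  So the rotations by c_i on Z/N,
   started at floor((k A_i mod n) / g), wrap around at pairwise disjoint sets of times.
   For the four tuples with distinct entries no such exact cover of Z/N exists.  For the other tuples
   the covers for k = 1, 2, ... soon contradict one another, as long as these k stay below g, and
   finitely many values of g remain. *)
theory Submission
  imports Defs
begin

subsection \<open>Exact covers by rotations\<close>

text \<open>A point \<open>x\<close> of \<open>{0..<N}\<close> wraps when adding \<open>c\<close> takes it to \<open>N\<close> or beyond. Nested conditionals are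
  used because \<open>code_simp\<close> does not evaluate conjunctions lazily.\<close>

primrec apart :: "int \<Rightarrow> int \<Rightarrow> int \<Rightarrow> nat \<Rightarrow> int \<Rightarrow> int \<Rightarrow> bool" where
  "apart N c c' 0 x x' = True"
| "apart N c c' (Suc j) x x' =
     (if N - c \<le> x then if N - c' \<le> x' then False
        else apart N c c' j ((x + c) mod N) ((x' + c') mod N)
      else apart N c c' j ((x + c) mod N) ((x' + c') mod N))"

text \<open>Here \<open>u\<close> stands for \<open>L * r div g\<close>: for every divisor \<open>k\<close> of \<open>L\<close> it determines
  \<open>k * r div g\<close> as \<open>u div (L div k)\<close>, so that finitely many \<open>u\<close> cover all residues \<open>r\<close> and all \<open>g\<close>.\<close>

definition compat :: "int \<Rightarrow> int \<Rightarrow> int list \<Rightarrow> int \<Rightarrow> int \<Rightarrow> int \<Rightarrow> int \<Rightarrow> bool" where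
  "compat N L ks c u c' u' =
     list_all (\<lambda>k. apart N c c' (nat N) (u div (L div k) mod N) (u' div (L div k) mod N)) ks"

text \<open>The first starting point is fixed at 0 because \<open>A 0 = 1\<close>. The nested
  filters discard incompatible pairs early, which keeps the search over the other three
  small.\<close>

definition no_triple :: "int \<Rightarrow> int \<Rightarrow> int list \<Rightarrow> int \<Rightarrow> int \<Rightarrow> int \<Rightarrow> int \<Rightarrow> bool" where
  "no_triple N L ks c0 c1 c2 c3 =
    (let us = [0..L * N - 1];
         us1 = filter (compat N L ks c0 0 c1) us;
         us2 = filter (compat N L ks c0 0 c2) us;
         us3 = filter (compat N L ks c0 0 c3) us
     in list_all (\<lambda>u1. let us3' = filter (compat N L ks c1 u1 c3) us3 in
          list_all (\<lambda>u2. list_all (\<lambda>u3. \<not> compat N L ks c2 u2 c3 u3) us3')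
           (filter (compat N L ks c1 u1 c2) us2)) us1)"

lemma no_tripleD:
  assumes "no_triple N L ks c0 c1 c2 c3"
    and "u1 \<in> {0..<L * N}" "u2 \<in> {0..<L * N}" "u3 \<in> {0..<L * N}"
    and "compat N L ks c0 0 c1 u1" "compat N L ks c0 0 c2 u2" "compat N L ks c0 0 c3 u3"
    and "compat N L ks c1 u1 c2 u2" "compat N L ks c1 u1 c3 u3" "compat N L ks c2 u2 c3 u3"
  shows False
  using assms unfolding no_triple_def Let_def list_all_iff by auto

lemma apartI:
  assumes "\<And>i. \<not> (N - c \<le> (x + i * c) mod N \<and> N - c' \<le> (x' + i * c') mod N)"
  shows "apart N c c' j (x mod N) (x' mod N)"
  using assms
proof (induction j arbitrary: x x')
  case (Suc j)
  have "\<not> (N - c \<le> (x + c + i * c) mod N \<and> N - c' \<le> (x' + c' + i * c') mod N)" for i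
    using Suc.prems[of "i + 1"] by (simp add: algebra_simps)
  from Suc.IH[OF this] show ?case
    using Suc.prems[of 0] by (simp add: mod_simps)
qed simp

lemma sum_lessThan_4: "(\<Sum>i<4. f i) = f 0 + f 1 + f 2 + f (3::nat)"
  by (simp add: eval_nat_numeral)

lemma le_div_iff_mult_le_int:
  fixes m x g :: int
  assumes "g > 0"
  shows "m \<le> x div g \<longleftrightarrow> m * g \<le> x"
proof
  assume "m \<le> x div g"
  then have "m * g \<le> x div g * g" using assms by (intro mult_right_mono) auto
  also have "\<dots> \<le> x" using div_mult_mod_eq[of x g] pos_mod_sign[OF assms, of x] by linarith
  finally show "m * g \<le> x" .
next
  assume "m * g \<le> x"
  from zdiv_mono1[OF this assms] show "m \<le> x div g" using assms by simp
qed

lemma mod_mult_div: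
  fixes x g N :: int
  assumes "g > 0" "N \<ge> 0"
  shows "x mod (g * N) div g = x div g mod N"
  using assms by (simp add: zmod_zmult2_eq)

section \<open>Finite searches: residues for small \<open>g\<close>, and covers\<close>

text \<open>The candidates are the lifts modulo \<open>g * N\<close> of the residues
  \<open>c i\<close> modulo \<open>N\<close>, as in \<open>residue_cases\<close>; the first residue
  is 1. The lists \<open>ks\<close> used below contain no multiple of \<open>g\<close>.\<close>

definition solutions :: "int \<Rightarrow> int \<Rightarrow> int list \<Rightarrow> int \<Rightarrow> int \<Rightarrow> int \<Rightarrow> (int \<times> int \<times> int) list" where
  "solutions N g ks c1 c2 c3 =
    filter (\<lambda>(r1, r2, r3). list_all (\<lambda>k. k mod (g * N) + k * r1 mod (g * N) + k * r2 mod (g * N)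
        + k * r3 mod (g * N) = 2 * (g * N)) ks)
      (List.product (map (\<lambda>e. c1 + N * e) [0..g - 1])
        (List.product (map (\<lambda>e. c2 + N * e) [0..g - 1]) (map (\<lambda>e. c3 + N * e) [0..g - 1])))"

lemma solutions_7_2: "solutions 7 2 [1, 7] 1 2 3 = []"
  by code_simp

lemma solutions_5_2: "solutions 5 2 [1, 5] 1 1 2 = []"
  by code_simp

lemma solutions_5_3: "solutions 5 3 [1, 4, 5] 1 1 2 = []"
  by code_simp

lemma solutions_4_2: "solutions 4 2 [1, 3] 1 1 1 = []"
  by code_simp

lemma solutions_4_3: "solutions 4 3 [1, 2, 4] 1 1 1 = []"
  by code_simp

lemma solutions_4_4: "solutions 4 4 [1, 2, 3, 6] 1 1 1 = []"
  by code_simp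

text \<open>The exceptional case: the surviving triples are the orderings of 9, 13 and 17, the
  negatives modulo 20 of 11, 7 and 3.\<close>

lemma solutions_4_5: "solutions 4 5 [1, 2, 3, 4] 1 1 1 =
    [(9, 13, 17), (9, 17, 13), (13, 9, 17), (13, 17, 9), (17, 9, 13), (17, 13, 9)]"
  by code_simp

lemma no_triple_2_1_3_5: "no_triple 11 1 [1] 2 1 3 5"
  by code_simp

lemma no_triple_1_3_4_5: "no_triple 13 1 [1] 1 3 4 5"
  by code_simp

lemma no_triple_2_3_5_7: "no_triple 17 1 [1] 2 3 5 7"
  by code_simp

lemma no_triple_3_5_4_7: "no_triple 19 1 [1] 3 5 4 7"
  by code_simp

text \<open>With repeated entries a cover for \<open>k = 1\<close> alone can exist, so several
  \<open>k\<close> are tested together. \<open>L\<close> is their least common multiple, and the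
  largest of them decides which small \<open>g\<close> are left to enumeration.\<close>

lemma no_triple_1_1_2_3: "no_triple 7 2 [1, 2] 1 1 2 3"
  by code_simp

lemma no_triple_1_1_1_2: "no_triple 5 6 [1, 2, 3] 1 1 1 2"
  by code_simp

lemma no_triple_1_1_1_1: "no_triple 4 60 [1, 2, 3, 4, 5] 1 1 1 1"
  by code_simp

section \<open>Residues with constant sum and the times at which they wrap\<close>

text \<open>The barycentric coordinates of \<open>w\<close> are \<open>c i / N\<close>, and those of the \<open>k\<close>-th class of lattice points
  are \<open>k * A i / (g * N)\<close> modulo 1; by \<open>A_cong\<close>, \<open>w\<close> lies in the class of \<open>k = g * c 0\<close>.\<close>

locale balanced =
  fixes A c :: "nat \<Rightarrow> int" and g N :: int
  assumes g_gt_1: "g > 1"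
    and c_pos: "i < 4 \<Longrightarrow> c i > 0"
    and N_eq: "N = (\<Sum>i<4. c i)"
    and A_0: "A 0 = 1"
    and A_cong: "i < 4 \<Longrightarrow> g * c 0 * A i mod (g * N) = g * c i mod (g * N)"
    and sum_residues: "\<not> g dvd k \<Longrightarrow> (\<Sum>i<4. k * A i mod (g * N)) = 2 * (g * N)"
begin

lemma N_pos: "N > 0"
  unfolding N_eq using c_pos by (intro sum_pos) (auto simp: lessThan_empty_iff)

lemma c_less_N: "i < 4 \<Longrightarrow> c i < N"
proof -
  assume "i < 4"
  then have "i = 0 \<or> i = 1 \<or> i = 2 \<or> i = 3" by auto
  then show "c i < N" unfolding N_eq sum_lessThan_4
    using c_pos[of 0] c_pos[of 1] c_pos[of 2] c_pos[of 3] by auto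
qed

text \<open>By \<open>A_cong\<close> the shift adds \<open>g * c i\<close> modulo
  \<open>g * N\<close>, and \<open>0 < c i < N\<close> allows at most one wrap. The threshold is a
  multiple of \<open>g\<close>, so the quotient by \<open>g\<close> decides whether it
  occurs.\<close>

lemma residue_step:
  assumes "i < 4"
  defines "x \<equiv> \<lambda>k. k * A i mod (g * N)"
  shows "x (k + g * c 0) = x k + g * c i - (if N - c i \<le> x k div g then g * N else 0)"
proof -
  have gN: "g * N > 0" using N_pos g_gt_1 by simp
  have x0: "0 \<le> x k" "x k < g * N" unfolding x_def using gN by auto
  have c0: "0 < g * c i" "g * c i < g * N" using assms(1) c_pos c_less_N g_gt_1 by auto
  have "x (k + g * c 0) = (k * A i + g * c 0 * A i) mod (g * N)"
    unfolding x_def by (simp add: algebra_simps)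
  also have "\<dots> = (x k + g * c i) mod (g * N)"
    using A_cong[OF assms(1)] unfolding x_def by (metis mod_add_cong mod_mod_trivial)
  also have "\<dots> = x k + g * c i - (if g * N \<le> x k + g * c i then g * N else 0)"
  proof (cases "g * N \<le> x k + g * c i")
    case True
    have "(x k + g * c i) mod (g * N) = (x k + g * c i - g * N) mod (g * N)" by simp
    also have "\<dots> = x k + g * c i - g * N"
      using True x0 c0 by (intro mod_pos_pos_trivial) linarith+
    finally show ?thesis using True by simp
  qed (use x0 c0 in \<open>auto intro!: mod_pos_pos_trivial\<close>)
  also have "g * N \<le> x k + g * c i \<longleftrightarrow> (N - c i) * g \<le> x k" by (auto simp: algebra_simps)
  also have "\<dots> \<longleftrightarrow> N - c i \<le> x k div g"
    using g_gt_1 by (simp add: le_div_iff_mult_le_int)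
  finally show ?thesis .
qed

text \<open>The residue moves in steps of \<open>g * c i\<close>, a multiple of \<open>g\<close>, so
  its quotient by \<open>g\<close> undergoes the rotation by \<open>c i\<close> on
  \<open>Z/N\<close>.\<close>

lemma residue_orbit:
  assumes "i < 4"
  shows "(k + j * (g * c 0)) * A i mod (g * N) div g = (k * A i mod (g * N) div g + j * c i) mod N"
proof -
  have "(k + j * (g * c 0)) * A i mod (g * N) = (k * A i + j * (g * c 0 * A i)) mod (g * N)"
    by (simp add: algebra_simps)
  also have "\<dots> = (k * A i mod (g * N) + j * (g * c i)) mod (g * N)"
    using A_cong[OF assms] by (metis mod_add_cong mod_mod_trivial mod_mult_right_eq)
  finally have "(k + j * (g * c 0)) * A i mod (g * N) div g = (k * A i mod (g * N) + g * (j * c i)) div g mod N"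
    using g_gt_1 N_pos by (simp add: mod_mult_div mult.left_commute)
  then show ?thesis using g_gt_1 by (simp add: add.commute)
qed

text \<open>Neither \<open>k'\<close> nor \<open>k' + g * c 0\<close> is a multiple of
  \<open>g\<close>, so both residue sums are \<open>2 * (g * N)\<close>. The increments
  \<open>g * c i\<close> total \<open>g * N\<close>, which exactly one wrap compensates; two would
  be too many.\<close>

lemma wraps_disjoint:
  assumes "\<not> g dvd k" "i < 4" "i' < 4" "i \<noteq> i'"
  defines "m \<equiv> \<lambda>i. k * A i mod (g * N) div g"
  shows "\<not> (N - c i \<le> (m i + j * c i) mod N \<and> N - c i' \<le> (m i' + j * c i') mod N)"
proof
  define k' where "k' = k + j * (g * c 0)"
  define P where "P = (\<lambda>i. N - c i \<le> k' * A i mod (g * N) div g)"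
  assume "N - c i \<le> (m i + j * c i) mod N \<and> N - c i' \<le> (m i' + j * c i') mod N"
  then have P: "P i" "P i'"
    unfolding P_def k'_def m_def using residue_orbit assms(2,3) by simp_all
  have *: "\<not> g dvd k'" "\<not> g dvd k' + g * c 0"
    unfolding k'_def using assms(1)
    by (metis dvd_add_left_iff dvd_triv_left dvd_mult)+
  have "2 * (g * N) = (\<Sum>i<4. k' * A i mod (g * N) + g * c i - (if P i then g * N else 0))"
    unfolding sum_residues[OF *(2), symmetric] P_def by (intro sum.cong refl residue_step) auto
  also have "\<dots> = 2 * (g * N) + g * N - (\<Sum>i<4. if P i then g * N else 0)"
    by (simp add: sum_subtractf sum.distrib sum_residues[OF *(1)] sum_distrib_left[symmetric]
        N_eq[symmetric])
  finally have "(\<Sum>i<4. if P i then g * N else 0) = g * N"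
    by (simp add: mult.commute)
  moreover have "(\<Sum>i\<in>{i, i'}. if P i then g * N else 0) \<le> (\<Sum>i<4. if P i then g * N else 0)"
    using assms(2,3) g_gt_1 N_pos by (intro sum_mono2) auto
  moreover have "g * N > 0" using g_gt_1 N_pos by simp
  moreover have "(\<Sum>i\<in>{i, i'}. if P i then g * N else 0) = 2 * (g * N)"
    using P assms(4) by simp
  ultimately show False by linarith
qed

text \<open>As \<open>0 < k < g\<close>, no \<open>k\<close> in \<open>ks\<close> is a multiple of
  \<open>g\<close>. Hence \<open>wraps_disjoint\<close> applies to each, and the numbers
  \<open>u i\<close> pass every test of the search.\<close>

lemma no_triple_False:
  assumes "no_triple N L ks (c 0) (c 1) (c 2) (c 3)" "L > 0"
    and ks: "\<And>k. k \<in> set ks \<Longrightarrow> 0 < k \<and> k < g \<and> k dvd L"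
  shows False
proof -
  define r where "r i = A i mod (g * N)" for i
  \<comment> \<open>The value 0 for \<open>i = 0\<close> replaces \<open>L div g\<close>, which may
    be positive. This is harmless since \<open>r 0 = 1\<close> gives
    \<open>k * r 0 div g = 0\<close> for all \<open>k < g\<close>.\<close>
  define u where "u i = (if i = 0 then 0 else L * r i div g)" for i
  have gN: "g * N > 0" using N_pos g_gt_1 by simp
  have r: "0 \<le> r i" "r i < g * N" for i unfolding r_def using gN by auto
  have quot: "u i div (L div k) mod N = k * A i mod (g * N) div g" if "k \<in> set ks" for i k
  proof -
    from ks[OF that] obtain q where k: "0 < k" "k < g" and q: "L = k * q" by (auto elim: dvdE)
    have "q > 0" using q \<open>L > 0\<close> k by (simp add: zero_less_mult_iff)
    have "k * A i mod (g * N) div g = k * r i mod (g * N) div g"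
      unfolding r_def by (simp add: mod_mult_right_eq)
    also have "\<dots> = k * r i div g mod N" using g_gt_1 N_pos by (simp add: mod_mult_div)
    also have "k * r i div g = u i div (L div k)"
    proof (cases "i = 0")
      case True
      have "g * 1 \<le> g * N" using N_pos g_gt_1 by (intro mult_left_mono) auto
      then have "1 < g * N" using g_gt_1 by linarith
      then have "r 0 = 1" by (simp add: r_def A_0)
      with True k show ?thesis by (simp add: u_def)
    next
      case False
      have "L * r i div g div q = (q * (k * r i)) div (q * g)"
        using q \<open>q > 0\<close> by (simp add: zdiv_zmult2_eq[symmetric] mult_ac)
      also have "\<dots> = k * r i div g" using \<open>q > 0\<close> by simp
      finally show ?thesis using False q k by (simp add: u_def)
    qed
    finally show ?thesis by simp
  qed
  have compat: "compat N L ks (c i) (u i) (c i') (u i')" if "i < 4" "i' < 4" "i \<noteq> i'" for i i'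
    unfolding compat_def list_all_iff
  proof
    fix k assume k: "k \<in> set ks"
    have "\<not> g dvd k" using ks[OF k] zdvd_not_zless by blast
    from apartI[OF wraps_disjoint[OF this that]]
    show "apart N (c i) (c i') (nat N) (u i div (L div k) mod N) (u i' div (L div k) mod N)"
      by (simp add: quot[OF k, symmetric])
  qed
  have range: "u i \<in> {0..<L * N}" for i
  proof -
    have "L * r i < L * (g * N)" using r[of i] \<open>L > 0\<close> by simp
    then have "L * r i div g < L * N"
      using g_gt_1 by (simp add: not_le[symmetric] le_div_iff_mult_le_int mult_ac)
    moreover have "0 \<le> L * r i div g"
      using r[of i] \<open>L > 0\<close> g_gt_1 by (simp add: pos_imp_zdiv_nonneg_iff)
    ultimately show ?thesis using \<open>L > 0\<close> N_pos by (simp add: u_def)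
  qed
  show False
    using no_tripleD[OF assms(1) range[of 1] range[of 2] range[of 3]]
      compat[of 0 1] compat[of 0 2] compat[of 0 3] compat[of 1 2] compat[of 1 3] compat[of 2 3]
    by (simp add: u_def)
qed

section \<open>Elimination of the tuples\<close>

text \<open>When \<open>c 0 = 1\<close>, cancelling \<open>g\<close> in \<open>A_cong\<close> leaves
  \<open>A i\<close> congruent to \<open>c i\<close> modulo \<open>N\<close>, which has
  \<open>g\<close> lifts modulo \<open>g * N\<close>.\<close>

lemma residue_cases:
  assumes "i < 4" "c 0 = 1"
  shows "A i mod (g * N) \<in> set (map (\<lambda>e. c i + N * e) [0..g - 1])"
proof -
  have "g * A i mod (g * N) = g * c i mod (g * N)" using A_cong[OF assms(1)] assms(2) by simp
  then have "A i mod N = c i mod N" using g_gt_1 by (simp add: mult_mod_right[symmetric])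
  then have "A i mod N = c i" using c_pos[OF assms(1)] c_less_N[OF assms(1)] by simp
  moreover have "A i mod (g * N) = N * (A i div N mod g) + A i mod N"
    using g_gt_1 N_pos by (simp add: zmod_zmult2_eq mult.commute[of g])
  moreover have "A i div N mod g \<in> {0..<g}" using g_gt_1 by simp
  ultimately show ?thesis by auto
qed

lemma sum_residues':
  assumes "\<not> g dvd k"
  shows "k mod (g * N) + k * (A 1 mod (g * N)) mod (g * N) + k * (A 2 mod (g * N)) mod (g * N)
    + k * (A 3 mod (g * N)) mod (g * N) = 2 * (g * N)"
  using sum_residues[OF assms] by (simp add: sum_lessThan_4 A_0 mod_mult_right_eq)

lemma False_2_1_3_5: "c 0 = 2 \<Longrightarrow> c 1 = 1 \<Longrightarrow> c 2 = 3 \<Longrightarrow> c 3 = 5 \<Longrightarrow> False"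
  using no_triple_False[of 1 "[1]"] no_triple_2_1_3_5 g_gt_1
  by (simp add: N_eq sum_lessThan_4)

lemma False_1_3_4_5: "c 0 = 1 \<Longrightarrow> c 1 = 3 \<Longrightarrow> c 2 = 4 \<Longrightarrow> c 3 = 5 \<Longrightarrow> False"
  using no_triple_False[of 1 "[1]"] no_triple_1_3_4_5 g_gt_1
  by (simp add: N_eq sum_lessThan_4)

lemma False_2_3_5_7: "c 0 = 2 \<Longrightarrow> c 1 = 3 \<Longrightarrow> c 2 = 5 \<Longrightarrow> c 3 = 7 \<Longrightarrow> False"
  using no_triple_False[of 1 "[1]"] no_triple_2_3_5_7 g_gt_1
  by (simp add: N_eq sum_lessThan_4)

lemma False_3_5_4_7: "c 0 = 3 \<Longrightarrow> c 1 = 5 \<Longrightarrow> c 2 = 4 \<Longrightarrow> c 3 = 7 \<Longrightarrow> False"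
  using no_triple_False[of 1 "[1]"] no_triple_3_5_4_7 g_gt_1
  by (simp add: N_eq sum_lessThan_4)

lemma residues_in_solutions:
  assumes "c 0 = 1" "list_all (\<lambda>k. \<not> g dvd k) ks"
  shows "(A 1 mod (g * N), A 2 mod (g * N), A 3 mod (g * N))
    \<in> set (solutions N g ks (c 1) (c 2) (c 3))"
  using residue_cases[of 1] residue_cases[of 2] residue_cases[of 3] sum_residues' assms
  by (simp add: solutions_def list_all_iff del: set_map)

text \<open>The values \<open>k = 1\<close> and \<open>k = 2\<close> are both below \<open>g\<close>
  once \<open>g > 2\<close>; the case \<open>g = 2\<close> is enumerated.\<close>

lemma False_1_1_2_3:
  assumes c: "c 0 = 1" "c 1 = 1" "c 2 = 2" "c 3 = 3"
  shows False
proof (cases "g > 2")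
  case True
  show False
    by (rule no_triple_False[of 2 "[1, 2]"])
      (use True no_triple_1_1_2_3 c in \<open>auto simp: N_eq sum_lessThan_4\<close>)
next
  case False
  with g_gt_1 have "g = 2" by simp
  moreover have "N = 7" using c by (simp add: N_eq sum_lessThan_4)
  ultimately show False
    using residues_in_solutions[of "[1, 7]"] c solutions_7_2 by auto
qed

lemma False_1_1_1_2:
  assumes c: "c 0 = 1" "c 1 = 1" "c 2 = 1" "c 3 = 2"
  shows False
proof (cases "g > 3")
  case True
  show False
    by (rule no_triple_False[of 6 "[1, 2, 3]"])
      (use True no_triple_1_1_1_2 c in \<open>auto simp: N_eq sum_lessThan_4\<close>)
next
  case False
  with g_gt_1 have g: "g = 2 \<or> g = 3" by auto
  have N: "N = 5" using c by (simp add: N_eq sum_lessThan_4)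
  have "g \<noteq> 2"
    using residues_in_solutions[of "[1, 5]"] c N solutions_5_2 by auto
  moreover have "g \<noteq> 3"
    using residues_in_solutions[of "[1, 4, 5]"] c N solutions_5_3 by auto
  ultimately show False using g by auto
qed

text \<open>The search with \<open>k\<close> up to 5 settles \<open>g > 5\<close>. Enumeration
  excludes 2, 3 and 4 and leaves six residue triples for 5.\<close>

lemma g_eq_5:
  assumes c: "c 0 = 1" "c 1 = 1" "c 2 = 1" "c 3 = 1"
  shows "g = 5 \<and> (A 1 mod 20, A 2 mod 20, A 3 mod 20) \<in> set
    [(9, 13, 17), (9, 17, 13), (13, 9, 17), (13, 17, 9), (17, 9, 13), (17, 13, 9)]"
proof -
  have N: "N = 4" using c by (simp add: N_eq sum_lessThan_4)
  have "\<not> g > 5"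
  proof
    assume "g > 5"
    show False
      by (rule no_triple_False[of 60 "[1, 2, 3, 4, 5]"])
        (use \<open>g > 5\<close> no_triple_1_1_1_1 c in \<open>auto simp: N_eq sum_lessThan_4\<close>)
  qed
  then have "g = 2 \<or> g = 3 \<or> g = 4 \<or> g = 5" using g_gt_1 by auto
  moreover have "g \<noteq> 2"
    using residues_in_solutions[of "[1, 3]"] c N solutions_4_2 by auto
  moreover have "g \<noteq> 3"
    using residues_in_solutions[of "[1, 2, 4]"] c N solutions_4_3 by auto
  moreover have "g \<noteq> 4"
    using residues_in_solutions[of "[1, 2, 3, 6]"] c N solutions_4_4 by auto
  ultimately have "g = 5" by auto
  then show ?thesis
    using residues_in_solutions[of "[1, 2, 3, 4]"] c N solutions_4_5 by simp
qed

end

subsection \<open>Unimodular maps and the tetrahedra $T_{a,b,n}$\<close>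

definition unimodular :: "real^3^3 \<Rightarrow> bool" where
  "unimodular M \<longleftrightarrow> (\<forall>i j. M $ i $ j \<in> \<int>) \<and> (det M = 1 \<or> det M = -1)"

text \<open>The map condition of \<open>equivalent\<close>, stated for arbitrary sets so that moves
  compose on bare vertex sets.\<close>

definition lattice_equiv :: "(real^3) set \<Rightarrow> (real^3) set \<Rightarrow> bool" where
  "lattice_equiv X Y \<longleftrightarrow>
     (\<exists>M u. unimodular M \<and> u \<in> int_lattice \<and> (\<lambda>v. M *v v + u) ` X = Y)"

definition T_vertices :: "int \<Rightarrow> int \<Rightarrow> int \<Rightarrow> (real^3) set" where
  "T_vertices a b n = {vector [0, 0, 0], vector [1, 0, 0], vector [0, 1, 0],
      vector [of_int a, of_int b, of_int n]}"

lemma equivalent_iff: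
  "equivalent S T \<longleftrightarrow> lattice_tetrahedron S \<and> lattice_tetrahedron T \<and>
     lattice_equiv (vertices S) (vertices T)"
  unfolding equivalent_def lattice_equiv_def unimodular_def by auto

lemma unimodular_mult:
  assumes "unimodular M" "unimodular M'"
  shows "unimodular (M ** M')"
proof -
  have "(M ** M') $ i $ j \<in> \<int>" for i j
    using assms unfolding unimodular_def matrix_matrix_mult_def by (auto intro!: Ints_sum Ints_mult)
  then show ?thesis using assms unfolding unimodular_def by (auto simp: det_mul)
qed

lemma int_lattice_mult: "\<forall>i j. M $ i $ j \<in> \<int> \<Longrightarrow> x \<in> int_lattice \<Longrightarrow> M *v x \<in> int_lattice"
  unfolding int_lattice_def matrix_vector_mult_def by (auto intro!: Ints_sum Ints_mult)

lemma int_lattice_add: "x \<in> int_lattice \<Longrightarrow> y \<in> int_lattice \<Longrightarrow> x + y \<in> int_lattice"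
  unfolding int_lattice_def by auto

lemma int_lattice_diff: "x \<in> int_lattice \<Longrightarrow> y \<in> int_lattice \<Longrightarrow> x - y \<in> int_lattice"
  unfolding int_lattice_def by auto

lemma int_lattice_vector [simp]:
  "vector [x, y, z] \<in> int_lattice \<longleftrightarrow> x \<in> \<int> \<and> y \<in> \<int> \<and> z \<in> \<int>"
  unfolding int_lattice_def by (auto simp: forall_3 vector_3)

text \<open>Cramer's rule writes each coordinate of \<open>x\<close> as an integer determinant
  divided by \<open>det M\<close>, which is 1 or -1.\<close>

lemma unimodular_int_lattice:
  assumes "unimodular M" "M *v x \<in> int_lattice"
  shows "x \<in> int_lattice"
proof -
  have "det M \<noteq> 0" using assms(1) unfolding unimodular_def by auto
  from cramer[OF this, of x "M *v x"]
  have x: "x = (\<chi> k. det (\<chi> i j. if j = k then (M *v x) $ i else M $ i $ j) / det M)" by simp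
  have "det (\<chi> i j. if j = k then (M *v x) $ i else M $ i $ j) \<in> \<int>" for k
    using assms unfolding unimodular_def int_lattice_def det_3
    by (auto intro!: Ints_add Ints_diff Ints_mult)
  then have "det (\<chi> i j. if j = k then (M *v x) $ i else M $ i $ j) / det M \<in> \<int>" for k
    using assms(1) unfolding unimodular_def by (auto intro: Ints_minus)
  then show ?thesis by (subst x) (simp add: int_lattice_def)
qed

lemma lattice_equiv_trans:
  assumes "lattice_equiv X Y" "lattice_equiv Y Z"
  shows "lattice_equiv X Z"
proof -
  from assms obtain M u M' u' where
    *: "unimodular M" "u \<in> int_lattice" "(\<lambda>v. M *v v + u) ` X = Y"
      "unimodular M'" "u' \<in> int_lattice" "(\<lambda>v. M' *v v + u') ` Y = Z"
    unfolding lattice_equiv_def by blast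
  have "(\<lambda>v. (M' ** M) *v v + (M' *v u + u')) ` X = Z"
    unfolding *(6)[symmetric] *(3)[symmetric] image_image
    by (simp add: matrix_vector_right_distrib matrix_vector_mul_assoc algebra_simps)
  moreover have "M' *v u + u' \<in> int_lattice"
    using *(2,4,5) int_lattice_mult int_lattice_add unfolding unimodular_def by blast
  ultimately show ?thesis unfolding lattice_equiv_def using unimodular_mult[OF *(4,1)] by blast
qed

section \<open>Explicit equivalences between the tetrahedra \<open>T_abn\<close>\<close>

lemma matrix3_vector:
  "(vector [vector [a, b, c], vector [d, e, f], vector [g, h, i]] :: real^3^3) *v vector [x, y, z]
     = vector [a * x + b * y + c * z, d * x + e * y + f * z, g * x + h * y + i * z]"
  by (simp add: vec_eq_iff forall_3 matrix_vector_mult_def sum_3 vector_3)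

lemma unimodular_vector:
  "unimodular (vector [vector [a, b, c], vector [d, e, f], vector [g, h, i]]) \<longleftrightarrow>
    a \<in> \<int> \<and> b \<in> \<int> \<and> c \<in> \<int> \<and> d \<in> \<int> \<and> e \<in> \<int> \<and> f \<in> \<int> \<and> g \<in> \<int> \<and> h \<in> \<int> \<and> i \<in> \<int> \<and>
    \<bar>a * e * i + b * f * g + c * d * h - a * f * h - b * d * i - c * e * g\<bar> = 1"
  unfolding unimodular_def by (auto simp: forall_3 vector_3 det_3)

lemma vector3_add: "vector [x, y, z] + vector [x', y', z'] = (vector [x + x', y + y', z + z'] :: real^3)"
  by (simp add: vec_eq_iff forall_3 vector_3)

lemma vector3_scaleR: "r *\<^sub>R vector [x, y, z] = (vector [r * x, r * y, r * z] :: real^3)"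
  by (simp add: vec_eq_iff forall_3 vector_3)

lemma vector3_eq_iff [simp]:
  "vector [x, y, z] = (vector [x', y', z'] :: real^3) \<longleftrightarrow> x = x' \<and> y = y' \<and> z = z'"
  by (auto simp: vec_eq_iff forall_3 vector_3)

lemma T_vertices_shear: "lattice_equiv (T_vertices a b n) (T_vertices (a + s * n) (b + t * n) n)"
  unfolding lattice_equiv_def
proof (intro exI conjI)
  let ?M = "vector [vector [1, 0, of_int s], vector [0, 1, of_int t], vector [0, 0, 1]] :: real^3^3"
  show "unimodular ?M" by (simp add: unimodular_vector)
  show "vector [0, 0, 0] \<in> int_lattice" by simp
  show "(\<lambda>v. ?M *v v + vector [0, 0, 0]) ` T_vertices a b n = T_vertices (a + s * n) (b + t * n) n"
    by (simp add: T_vertices_def matrix3_vector vector3_add)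
qed

lemma T_vertices_swap: "lattice_equiv (T_vertices a b n) (T_vertices b a n)"
  unfolding lattice_equiv_def
proof (intro exI conjI)
  let ?M = "vector [vector [0, 1, 0], vector [1, 0, 0], vector [0, 0, 1]] :: real^3^3"
  show "unimodular ?M" by (simp add: unimodular_vector)
  show "vector [0, 0, 0] \<in> int_lattice" by simp
  show "(\<lambda>v. ?M *v v + vector [0, 0, 0]) ` T_vertices a b n = T_vertices b a n"
    by (simp add: T_vertices_def matrix3_vector vector3_add insert_commute)
qed

text \<open>The affine map exchanges \<open>(0,0,0)\<close> and \<open>(1,0,0)\<close> and fixes
  \<open>(0,1,0)\<close>. Together with the swap it generates all permutations of the base
  triangle.\<close>

lemma T_vertices_reflect: "lattice_equiv (T_vertices a b n) (T_vertices (1 - a - b) b n)"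
  unfolding lattice_equiv_def
proof (intro exI conjI)
  let ?M = "vector [vector [-1, -1, 0], vector [0, 1, 0], vector [0, 0, 1]] :: real^3^3"
  show "unimodular ?M" by (simp add: unimodular_vector)
  show "vector [1, 0, 0] \<in> int_lattice" by simp
  show "(\<lambda>v. ?M *v v + vector [1, 0, 0]) ` T_vertices a b n = T_vertices (1 - a - b) b n"
    by (simp add: T_vertices_def matrix3_vector vector3_add insert_commute algebra_simps)
qed

lemma T_vertices_mod:
  "lattice_equiv (T_vertices a b n) (T_vertices (a mod n) (b mod n) n)"
  "lattice_equiv (T_vertices (a mod n) (b mod n) n) (T_vertices a b n)"
proof -
  have "a + - (a div n) * n = a mod n" "b + - (b div n) * n = b mod n"
    by (simp_all add: minus_div_mult_eq_mod)
  then show "lattice_equiv (T_vertices a b n) (T_vertices (a mod n) (b mod n) n)"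
    using T_vertices_shear[of a b n "- (a div n)" "- (b div n)"] by metis
  show "lattice_equiv (T_vertices (a mod n) (b mod n) n) (T_vertices a b n)"
    using T_vertices_shear[of "a mod n" "b mod n" n "a div n" "b div n"]
    by (simp only: mod_div_mult_eq)
qed

lemma T_vertices_reflect_mod:
  "lattice_equiv (T_vertices a b n) (T_vertices ((1 - a - b) mod n) (b mod n) n)"
  using T_vertices_reflect T_vertices_mod(1) by (rule lattice_equiv_trans)

lemma T_vertices_3_7_20:
  shows "lattice_equiv (T_vertices 3 7 20) (T_vertices 11 7 20)"
    and "lattice_equiv (T_vertices 3 7 20) (T_vertices 7 11 20)"
    and "lattice_equiv (T_vertices 3 7 20) (T_vertices 3 11 20)"
proof -
  show 1: "lattice_equiv (T_vertices 3 7 20) (T_vertices 11 7 20)"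
    using T_vertices_reflect_mod[of 3 7 20] by simp
  show 2: "lattice_equiv (T_vertices 3 7 20) (T_vertices 7 11 20)"
    using lattice_equiv_trans[OF 1 T_vertices_swap] .
  show "lattice_equiv (T_vertices 3 7 20) (T_vertices 3 11 20)"
    using lattice_equiv_trans[OF 2 T_vertices_reflect_mod[of 7 11 20]] by simp
qed

lemma T_vertices_equiv_3_7_20:
  assumes "(a mod 20, b mod 20) \<in> {(3, 7), (3, 11), (7, 3), (7, 11), (11, 3), (11, 7)}"
  shows "lattice_equiv (T_vertices a b 20) (T_vertices 3 7 20)"
proof (rule lattice_equiv_trans[OF T_vertices_mod(1)])
  have 1: "lattice_equiv (T_vertices 7 3 20) (T_vertices 3 7 20)"
    by (rule T_vertices_swap)
  have 2: "lattice_equiv (T_vertices 11 7 20) (T_vertices 3 7 20)"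
    using T_vertices_reflect_mod[of 11 7 20] by simp
  have 3: "lattice_equiv (T_vertices 7 11 20) (T_vertices 3 7 20)"
    using lattice_equiv_trans[OF T_vertices_swap 2] .
  have 4: "lattice_equiv (T_vertices 3 11 20) (T_vertices 3 7 20)"
    using lattice_equiv_trans[OF _ 3] T_vertices_reflect_mod[of 3 11 20] by simp
  have 5: "lattice_equiv (T_vertices 11 3 20) (T_vertices 3 7 20)"
    using lattice_equiv_trans[OF T_vertices_swap 4] .
  have 0: "lattice_equiv (T_vertices 3 7 20) (T_vertices 3 7 20)"
    using T_vertices_mod(1)[of 3 7 20] by simp
  show "lattice_equiv (T_vertices (a mod 20) (b mod 20) 20) (T_vertices 3 7 20)"
    using assms 0 1 2 3 4 5 by auto
qed

section \<open>Simplices, their lattice points and their volume\<close>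

lemma affine_independent_T_vertices:
  assumes "n \<noteq> 0"
  shows "\<not> affine_dependent (T_vertices a b n)" "card (T_vertices a b n) = 4"
proof -
  show "card (T_vertices a b n) = 4" using assms by (simp add: T_vertices_def)
  show "\<not> affine_dependent (T_vertices a b n)"
  proof
    assume "affine_dependent (T_vertices a b n)"
    then obtain U where U: "sum U (T_vertices a b n) = 0" "\<exists>v\<in>T_vertices a b n. U v \<noteq> 0"
      "(\<Sum>v\<in>T_vertices a b n. U v *\<^sub>R v) = 0"
      by (auto simp: affine_dependent_explicit_finite T_vertices_def)
    have 0: "(0::real^3) = vector [0, 0, 0]" by (simp add: vec_eq_iff forall_3 vector_3)
    from U(3) assms have "U (vector [of_int a, of_int b, of_int n]) = 0"
      "U (vector [1, 0, 0]) = 0" "U (vector [0, 1, 0]) = 0"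
      by (auto simp: T_vertices_def vector3_scaleR vector3_add 0)
    with U(1,2) assms show False by (auto simp: T_vertices_def)
  qed
qed

lemma
  assumes "n \<noteq> 0"
  shows vertices_T_abn: "vertices (T_abn a b n) = T_vertices a b n"
    and lattice_tetrahedron_T_abn: "lattice_tetrahedron (T_abn a b n)"
proof -
  have *: "T_abn a b n = convex hull (T_vertices a b n)" by (simp add: T_abn_def T_vertices_def)
  show v: "vertices (T_abn a b n) = T_vertices a b n"
    unfolding * vertices_def
    using extreme_point_of_convex_hull_affine_independent[OF affine_independent_T_vertices(1)[OF assms]]
    by simp
  have "3 simplex (T_abn a b n)" unfolding simplex_def *
    using affine_independent_T_vertices[OF assms] by fastforce
  then show "lattice_tetrahedron (T_abn a b n)"
    by (simp add: lattice_tetrahedron_def v) (simp add: T_vertices_def)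
qed

lemma simplex_vertices:
  fixes T :: "(real^3) set"
  assumes "3 simplex T"
  shows "T = convex hull (vertices T)" "finite (vertices T)" "card (vertices T) = 4"
proof -
  from assms obtain C where C: "\<not> affine_dependent C" "int (card C) = 3 + 1" "T = convex hull C"
    unfolding simplex_def by blast
  have "vertices T = C"
    unfolding C(3) vertices_def using extreme_point_of_convex_hull_affine_independent[OF C(1)] by simp
  with C show "T = convex hull (vertices T)" "finite (vertices T)" "card (vertices T) = 4"
    by (auto intro: aff_independent_finite)
qed

text \<open>In the interior, \<open>w\<close> is the only lattice point; any other point of
  \<open>T\<close> lies on the frontier, where cleanness leaves only vertices.\<close>

lemma one_point_cases:
  assumes "one_point_lattice_tetrahedron T" "w \<in> interior T" "w \<in> int_lattice"
    and "p \<in> T" "p \<in> int_lattice"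
  shows "p \<in> vertices T \<or> p = w"
proof (cases "p \<in> interior T")
  case True
  from assms(1) obtain y where "interior T \<inter> int_lattice = {y}"
    unfolding one_point_lattice_tetrahedron_def by (auto simp: card_1_singleton_iff)
  then have "p \<in> {y}" "w \<in> {y}" using True assms(2,3,5) by auto
  then show ?thesis by simp
next
  case False
  then have "p \<in> frontier T" using assms(4) closure_subset by (auto simp: frontier_def)
  with assms(1,5) show ?thesis
    unfolding one_point_lattice_tetrahedron_def clean_def by blast
qed

definition columns3 :: "real^3 \<Rightarrow> real^3 \<Rightarrow> real^3 \<Rightarrow> real^3^3" where
  "columns3 p q r = (\<chi> i j. (if j = 1 then p else if j = 2 then q else r) $ i)"

lemma mult_columns3: "M ** columns3 p q r = columns3 (M *v p) (M *v q) (M *v r)"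
  by (simp add: columns3_def matrix_matrix_mult_def matrix_vector_mult_def vec_eq_iff forall_3)

text \<open>\<open>v1\<close> serves as origin and \<open>v0\<close> comes last, so that the first
  two columns span the face opposite \<open>v0\<close>.\<close>

lemma content_tetrahedron:
  fixes v0 v1 v2 v3 :: "real^3"
  assumes "distinct [v0, v1, v2, v3]"
  shows "measure lborel (convex hull {v0, v1, v2, v3})
    = \<bar>det (columns3 (v2 - v1) (v3 - v1) (v0 - v1))\<bar> / 6"
proof -
  define f :: "3 \<Rightarrow> real^3" where "f j = (if j = 1 then v2 else if j = 2 then v3 else v0)" for j
  have f: "f 1 = v2" "f 2 = v3" "f 3 = v0" by (simp_all add: f_def)
  have 1: "inj f" unfolding inj_def forall_3 f using assms by auto
  have 2: "range f = {v0, v1, v2, v3} - {v1}"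
    unfolding UNIV_3 image_insert image_empty f using assms by auto
  have "bij_betw f UNIV ({v0, v1, v2, v3} - {v1})" unfolding bij_betw_def using 1 2 by (rule conjI)
  moreover have "finite {v0, v1, v2, v3}" "v1 \<in> {v0, v1, v2, v3}" by simp_all
  moreover have "card {v0, v1, v2, v3} = Suc CARD(3)" using assms by simp
  ultimately have "measure lborel (convex hull {v0, v1, v2, v3}) = \<bar>det (\<chi> i j. f j $ i - v1 $ i)\<bar> / fact CARD(3)"
    using content_simplex by blast
  moreover have "(\<chi> i j. f j $ i - v1 $ i) = columns3 (v2 - v1) (v3 - v1) (v0 - v1)"
    by (simp add: vec_eq_iff columns3_def f_def)
  ultimately show ?thesis by (simp add: fact_numeral)
qed

section \<open>Integer row operations and empty triangles\<close>

text \<open>Dividing the Bezout identity \<open>s * p + t * q = d\<close> by \<open>d\<close> shows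
  that \<open>(- q', p')\<close> completes \<open>(s, t)\<close> to a matrix of determinant
  1.\<close>

lemma bezout_rows:
  fixes p q :: int
  obtains s t s' t' where "s * t' - t * s' = 1" "s * p + t * q \<ge> 0" "s' * p + t' * q = 0"
proof (cases "p = 0 \<and> q = 0")
  case True
  then show ?thesis using that[of 1 1 0 0] by simp
next
  case False
  define d where "d = gcd p q"
  have "d > 0" using False unfolding d_def by (simp add: gcd_pos_int)
  obtain s t where st: "s * p + t * q = d" using bezout_int d_def by metis
  obtain p' q' where pq: "p = d * p'" "q = d * q'" unfolding d_def by (metis dvdE gcd_dvd1 gcd_dvd2)
  have "d * (s * p' + t * q') = d * 1" using st by (simp add: pq algebra_simps)
  then have "s * p' + t * q' = 1" using \<open>d > 0\<close> by simp
  then show ?thesis using that[of s p' t "- q'"] st pq \<open>d > 0\<close> by (simp add: algebra_simps)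
qed

lemma int_lattice_cases:
  assumes "x \<in> int_lattice"
  obtains a b c :: int where "x = vector [of_int a, of_int b, of_int c]"
proof -
  from assms have "x $ 1 \<in> \<int>" "x $ 2 \<in> \<int>" "x $ 3 \<in> \<int>" unfolding int_lattice_def by auto
  then obtain a b c where "x $ 1 = of_int a" "x $ 2 = of_int b" "x $ 3 = of_int c"
    by (metis Ints_cases)
  then show ?thesis by (intro that[of a b c]) (simp add: vec_eq_iff forall_3 vector_3)
qed

text \<open>Only the last two coordinates are mixed. Fixing the first axis matters when another
  vector has already been moved there, as in \<open>hermite_normal_form\<close>.\<close>

lemma clear_third_entry:
  fixes a b c :: int
  obtains M :: "real^3^3" and d :: int where "unimodular M" "d \<ge> 0"
    "M *v vector [of_int a, of_int b, of_int c] = vector [of_int a, of_int d, 0]"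
    "\<And>x. M *v vector [x, 0, 0] = vector [x, 0, 0]"
proof -
  obtain s t s' t' where st: "s * t' - t * s' = 1" "s * b + t * c \<ge> 0" "s' * b + t' * c = 0"
    by (rule bezout_rows)
  have st_real: "real_of_int s * real_of_int t' - of_int t * of_int s' = 1"
    "real_of_int s' * of_int b + of_int t' * of_int c = 0"
    using st(1,3) by (simp_all flip: of_int_mult of_int_diff of_int_add)
  show ?thesis
    by (rule that[of "vector [vector [1, 0, 0], vector [0, of_int s, of_int t],
        vector [0, of_int s', of_int t']]" "s * b + t * c"])
      (use st(2) st_real in \<open>simp_all add: unimodular_vector matrix3_vector\<close>)
qed

lemma clear_second_entry:
  fixes a b :: int
  obtains M :: "real^3^3" and d :: int where "unimodular M" "d \<ge> 0"
    "M *v vector [of_int a, of_int b, 0] = vector [of_int d, 0, 0]"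
proof -
  obtain s t s' t' where st: "s * t' - t * s' = 1" "s * a + t * b \<ge> 0" "s' * a + t' * b = 0"
    by (rule bezout_rows)
  have st_real: "real_of_int s * real_of_int t' - of_int t * of_int s' = 1"
    "real_of_int s' * of_int a + of_int t' * of_int b = 0"
    using st(1,3) by (simp_all flip: of_int_mult of_int_diff of_int_add)
  show ?thesis
    by (rule that[of "vector [vector [of_int s, of_int t, 0], vector [of_int s', of_int t', 0],
        vector [0, 0, 1]]" "s * a + t * b"])
      (use st(2) st_real in \<open>simp_all add: unimodular_vector matrix3_vector\<close>)
qed

lemma hermite_normal_form:
  assumes "x \<in> int_lattice" "y \<in> int_lattice"
  obtains M :: "real^3^3" and p q r :: int where "unimodular M" "p \<ge> 0" "r \<ge> 0"
    "M *v x = vector [of_int p, 0, 0]" "M *v y = vector [of_int q, of_int r, 0]"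
proof -
  obtain a b c where x: "x = vector [of_int a, of_int b, of_int c]"
    using int_lattice_cases assms(1) by blast
  obtain M1 d where M1: "unimodular M1" "M1 *v x = vector [of_int a, of_int d, 0]"
    unfolding x by (rule clear_third_entry)
  obtain M2 p where M2: "unimodular M2" "p \<ge> 0" "M2 *v (M1 *v x) = vector [of_int p, 0, 0]"
    unfolding M1 by (rule clear_second_entry)
  have "(M2 ** M1) *v y \<in> int_lattice"
    using unimodular_mult[OF M2(1) M1(1)] assms(2) by (simp add: unimodular_def int_lattice_mult)
  then obtain q e f where y: "(M2 ** M1) *v y = vector [of_int q, of_int e, of_int f]"
    using int_lattice_cases by blast
  obtain M3 r where M3: "unimodular M3" "r \<ge> 0"
    "M3 *v ((M2 ** M1) *v y) = vector [of_int q, of_int r, 0]"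
    "\<And>x. M3 *v vector [x, 0, 0] = vector [x, 0, 0]"
    unfolding y by (rule clear_third_entry) blast
  show ?thesis
  proof (rule that[of "M3 ** (M2 ** M1)" p r q])
    show "(M3 ** (M2 ** M1)) *v x = vector [of_int p, 0, 0]"
      using M2(3) M3(4) by (simp flip: matrix_vector_mul_assoc)
  qed (use M1 M2 M3 unimodular_mult in \<open>auto simp flip: matrix_vector_mul_assoc\<close>)
qed


text \<open>In Hermite form \<open>d\<close> becomes \<open>(p, 0, 0)\<close> and \<open>e\<close>
  becomes \<open>(q, r, 0)\<close>. Emptiness of the edge \<open>d\<close> forces
  \<open>p = 1\<close>; if \<open>r > 1\<close>, the triangle would contain a lattice point with
  second coordinate 1 that is no vertex. A shear and a sign change finish.\<close>

lemma empty_triangle_unimodular: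
  fixes d e f :: "real^3"
  assumes "d \<in> int_lattice" "e \<in> int_lattice" "f \<in> int_lattice" "det (columns3 d e f) \<noteq> 0"
    and empty: "\<And>\<alpha> \<beta>. \<lbrakk>0 \<le> \<alpha>; 0 \<le> \<beta>; \<alpha> + \<beta> \<le> 1; \<alpha> *\<^sub>R d + \<beta> *\<^sub>R e \<in> int_lattice\<rbrakk>
      \<Longrightarrow> \<alpha> = 0 \<and> \<beta> = 0 \<or> \<alpha> = 1 \<and> \<beta> = 0 \<or> \<alpha> = 0 \<and> \<beta> = 1"
  obtains M :: "real^3^3" and a b n :: int where "unimodular M" "n > 0"
    "M *v d = vector [1, 0, 0]" "M *v e = vector [0, 1, 0]" 
    "M *v f = vector [of_int a, of_int b, of_int n]"
    "\<bar>det (columns3 d e f)\<bar> = of_int n"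
proof -
  have det: "\<bar>det (columns3 d e f)\<bar> = \<bar>det (columns3 (M *v d) (M *v e) (M *v f))\<bar>"
    if "unimodular M" for M
    using that by (auto simp: mult_columns3[symmetric] det_mul unimodular_def)
  have det': "det (columns3 (vector [x, 0, 0]) (vector [y, z, 0]) f') = x * z * f' $ 3" for x y z f'
    by (simp add: columns3_def det_3 vector_3)
  obtain M p q r where M: "unimodular M" "p \<ge> 0" "r \<ge> 0" and
    d: "M *v d = vector [of_int p, 0, 0]" and e: "M *v e = vector [of_int q, of_int r, 0]"
    using hermite_normal_form[OF assms(1,2)] by blast
  have "p \<noteq> 0" "r \<noteq> 0" using assms(4) det[OF M(1)] unfolding d e det' by auto
  with M have pr: "p > 0" "r > 0" by auto
  have "M *v ((1 / of_int p) *\<^sub>R d + 0 *\<^sub>R e) = vector [1, 0, 0]"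
    using pr by (simp add: matrix_vector_mult_scaleR d vector3_scaleR)
  then have "(1 / of_int p) *\<^sub>R d + 0 *\<^sub>R e \<in> int_lattice"
    using unimodular_int_lattice[OF M(1)] by simp
  moreover have "0 < 1 / real_of_int p" "1 / real_of_int p \<le> 1" using pr by simp_all
  ultimately have "1 / real_of_int p = 1" using empty[of "1 / of_int p" 0] by force
  then have p: "p = 1" by simp
  \<comment> \<open>At second coordinate 1 the triangle covers the interval from
    \<open>q / r\<close> to \<open>q / r + 1 - 1 / r\<close>. Its ends are multiples of
    \<open>1 / r\<close>, so the ceiling of the left end lies in it; \<alpha> is the resulting
    coefficient of \<open>d\<close>.\<close>
  define x where "x = \<lceil>real_of_int q / of_int r\<rceil>"
  define \<alpha> where "\<alpha> = of_int x - real_of_int q / of_int r"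
  have "\<alpha> \<ge> 0" unfolding \<alpha>_def x_def by simp
  have "of_int (x * r) < real_of_int (q + r)"
    using ceiling_correct[of "real_of_int q / of_int r"] pr unfolding x_def[symmetric]
    by (simp add: field_simps)
  then have "x * r + 1 \<le> q + r" by linarith
  then have "real_of_int x * of_int r + 1 \<le> of_int q + of_int r" 
    by (simp flip: of_int_mult of_int_add)
  then have "\<alpha> + 1 / of_int r \<le> 1" using pr unfolding \<alpha>_def by (simp add: field_simps)
  have "M *v (\<alpha> *\<^sub>R d + (1 / of_int r) *\<^sub>R e) = vector [of_int x, 1, 0]"
    using pr by (simp add: matrix_vector_right_distrib matrix_vector_mult_scaleR d e vector3_scaleR
      vector3_add p \<alpha>_def)
  then have "\<alpha> *\<^sub>R d + (1 / of_int r) *\<^sub>R e \<in> int_lattice"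
    using unimodular_int_lattice[OF M(1)] by simp
  moreover have "0 < 1 / real_of_int r" using pr by simp
  ultimately have "1 / real_of_int r = 1"
    using empty[of \<alpha> "1 / of_int r"] \<open>\<alpha> \<ge> 0\<close> \<open>\<alpha> + 1 / of_int r \<le> 1\<close> by force
  then have r: "r = 1" by simp
  have "M *v f \<in> int_lattice" using M(1) assms(3) by (simp add: unimodular_def int_lattice_mult)
  then obtain a b n where f: "M *v f = vector [of_int a, of_int b, of_int n]"
    using int_lattice_cases by blast
  have n: "\<bar>det (columns3 d e f)\<bar> = \<bar>of_int n\<bar>"
    using det[OF M(1)] unfolding d e det' f by (simp add: p r vector_3)
  then have "n \<noteq> 0" using assms(4) by auto
  define M' :: "real^3^3" where
    "M' = vector [vector [1, - of_int q, 0], vector [0, 1, 0], vector [0, 0, of_int (sgn n)]]"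
  have M': "unimodular M'" using \<open>n \<noteq> 0\<close> unfolding M'_def unimodular_vector by (auto simp: sgn_if)
  show ?thesis
  proof (rule that[of "M' ** M" "\<bar>n\<bar>" "a - q * b" b])
    show "unimodular (M' ** M)" using M' M(1) by (rule unimodular_mult)
  qed (use \<open>n \<noteq> 0\<close> n in \<open>simp_all add: d e f p r M'_def matrix3_vector sgn_if
      flip: matrix_vector_mul_assoc\<close>)
qed

subsection \<open>From tetrahedra to residues\<close>

lemma less_4_cases: "i < (4::nat) \<Longrightarrow> i = 0 \<or> i = 1 \<or> i = 2 \<or> i = 3"
  by auto

text \<open>\<open>z\<close>, \<open>n * x - a * z\<close> and \<open>n * y - b * z\<close> are \<open>n\<close> times the barycentric coordinates of
  \<open>(x, y, z)\<close> with respect to \<open>(a, b, n)\<close>, \<open>(1, 0, 0)\<close> and \<open>(0, 1, 0)\<close>.\<close>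

lemma balancedI:
  fixes c :: "nat \<Rightarrow> int" and a b g N x\<^sub>w y\<^sub>w :: int
  defines "n \<equiv> g * N" and "A \<equiv> (!) [1, a + b - 1, - a, - b]"
  assumes "g > 1" "\<And>i. i < 4 \<Longrightarrow> c i > 0" "N = (\<Sum>i<4. c i)"
    and w: "N * x\<^sub>w = c 2 + c 0 * a" "N * y\<^sub>w = c 3 + c 0 * b"
    and empty: "\<And>x y z. \<lbrakk>0 \<le> z; 0 \<le> n * x - a * z; 0 \<le> n * y - b * z;
      z + (n * x - a * z) + (n * y - b * z) \<le> n\<rbrakk> \<Longrightarrow> z = 0 \<or> z = n \<or> z = g * c 0"
  shows "balanced A c g N"
proof
  show "g > 1" "N = (\<Sum>i<4. c i)" "A 0 = 1" by (simp_all add: assms)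
  show "c i > 0" if "i < 4" for i using that by (rule assms)
  have "N > 0" unfolding assms(5) by (rule sum_pos) (auto intro: assms(4) simp: lessThan_empty_iff)
  then have n: "n > 0" using \<open>g > 1\<close> by (simp add: n_def)
  show "g * c 0 * A i mod (g * N) = g * c i mod (g * N)" if "i < 4" for i
  proof -
    have "c 0 * A i = c i + N * (if i = 0 then 0 else if i = 1 then x\<^sub>w + y\<^sub>w - 1
        else if i = 2 then - x\<^sub>w else - y\<^sub>w)"
      using less_4_cases[OF that] w assms(5) unfolding A_def sum_lessThan_4
      by (elim disjE) (simp_all add: algebra_simps)
    then obtain q where "c 0 * A i = c i + N * q" by blast
    then have "g * c 0 * A i = g * c i + (g * N) * q" by (simp add: mult.assoc distrib_left)
    then show ?thesis by simp
  qed
  define R where "R k i = k * A i mod n" for k i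
  have R: "0 \<le> R k i" "R k i < n" for k i using n by (simp_all add: R_def)
  have R0: "R k 0 = k mod n" for k by (simp add: R_def A_def)
  \<comment> \<open>If the sum is \<open>n\<close>, the residues divided by \<open>n\<close> are the
    barycentric coordinates of a lattice point of the tetrahedron. By \<open>empty\<close> its
    height \<open>z = k mod n\<close> is a multiple of \<open>g\<close>, hence so is
    \<open>k\<close>.\<close>
  have not_n: "(\<Sum>i<4. R k i) \<noteq> n" if "\<not> g dvd k" for k
  proof
    assume sum: "(\<Sum>i<4. R k i) = n"
    define z where "z = R k 0"
    have mod: "u mod n = u - n * (u div n)" for u by (simp add: minus_mult_div_eq_mod)
    obtain x y where xy: "R k 2 + a * z = n * x" "R k 3 + b * z = n * y"
      by (rule that[of "- (- (a * k) div n) - a * (k div n)" "- (- (b * k) div n) - b * (k div n)"])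
        (simp_all add: z_def R_def A_def mod algebra_simps)
    have "z = 0 \<or> z = n \<or> z = g * c 0"
      by (rule empty[of z x y])
        (use R[of k 0] R[of k 1] R[of k 2] R[of k 3] sum xy in
          \<open>simp_all add: z_def[symmetric] sum_lessThan_4\<close>)
    then have "g dvd z" using R[of k 0] by (auto simp: z_def)
    then show False using that unfolding z_def R0 n_def by (simp add: dvd_mod_iff)
  qed
  show "(\<Sum>i<4. k * A i mod (g * N)) = 2 * (g * N)" if "\<not> g dvd k" for k
  proof -
    \<comment> \<open>The entries of \<open>A\<close> add up to 0, so the residue sum is
      \<open>n * s\<close>. Four residues below \<open>n\<close>, the first nonzero, give
      \<open>0 < s < 4\<close>.\<close>
    have "(\<Sum>i<4. R k i) mod n = k * (\<Sum>i<4. A i) mod n"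
      unfolding R_def sum_distrib_left by (rule mod_sum_eq)
    also have "(\<Sum>i<4. A i) = 0" by (simp add: A_def sum_lessThan_4)
    finally have "n dvd (\<Sum>i<4. R k i)" by auto
    then obtain s where s: "(\<Sum>i<4. R k i) = n * s" by (auto elim: dvdE)
    have "R k 0 \<noteq> 0" using that unfolding R0 n_def by (auto simp: mod_eq_0_iff_dvd)
    then have "n * 0 < n * s" "n * s < n * 4"
      using R[of k 0] R[of k 1] R[of k 2] R[of k 3] unfolding s[symmetric] sum_lessThan_4 by linarith+
    then have "0 < s" "s < 4" using n by (simp_all add: zero_less_mult_iff)
    moreover have "s \<noteq> 1" using not_n[OF that] s by auto
    moreover have "s \<noteq> 3"
    proof
      assume "s = 3"
      then have sum: "R k 0 + R k 1 + R k 2 + R k 3 = 3 * n" using s by (simp add: sum_lessThan_4)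
      \<comment> \<open>No residue vanishes, since three of them add up to less than
        \<open>3 * n\<close>. Negating \<open>k\<close> then turns the sum into
        \<open>4 * n - 3 * n = n\<close>.\<close>
      have "R (- k) i = n - R k i" if "i < 4" for i
      proof -
        have "R k i \<noteq> 0"
          using less_4_cases[OF that] sum R[of k 0] R[of k 1] R[of k 2] R[of k 3] by auto
        then show ?thesis unfolding R_def by (simp add: zmod_zminus1_eq_if)
      qed
      then have "(\<Sum>i<4. R (- k) i) = n" using sum by (simp add: sum_lessThan_4)
      then show False using not_n[of "- k"] that by simp
    qed
    ultimately have "s = 2" by linarith
    then show ?thesis using s unfolding R_def n_def by simp
  qed
qed

section \<open>Moving a tetrahedron into normal position\<close>

text \<open>A permutation matching the two coordinate lists is applied to the vertices as well, so
  the sum for \<open>w\<close> is merely reindexed.\<close>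

lemma barycentric_coords_reorder:
  assumes "barycentric_coords vs w \<mu>" "mset \<mu> = mset \<nu>"
  obtains vs' where "mset vs' = mset vs" "barycentric_coords vs' w \<nu>"
proof -
  have len: "length \<mu> = length vs" using assms(1) by (simp add: barycentric_coords_def)
  obtain p where p: "p permutes {..<length vs}" "permute_list p \<mu> = \<nu>"
    using mset_eq_permutation[OF assms(2)[symmetric]] len by auto
  let ?vs' = "permute_list p vs"
  have nth: "\<nu> ! j = \<mu> ! p j" "?vs' ! j = vs ! p j" if "j < length vs" for j
    using that p len by (auto simp: permute_list_nth)
  have "(\<Sum>j<length vs. \<nu> ! j *\<^sub>R ?vs' ! j) = (\<Sum>j<length vs. \<mu> ! j *\<^sub>R vs ! j)"
    using sum.permute[OF p(1), of "\<lambda>j. \<mu> ! j *\<^sub>R vs ! j"] by (simp add: nth)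
  moreover have "(\<Sum>j<length vs. \<nu> ! j) = (\<Sum>j<length vs. \<mu> ! j)"
    using sum.permute[OF p(1), of "\<lambda>j. \<mu> ! j"] by (simp add: nth)
  ultimately have "barycentric_coords ?vs' w \<nu>"
    using assms(1) p(2) len unfolding barycentric_coords_def by auto
  with p(1) show ?thesis by (intro that) simp_all
qed

lemma columns3_mult_vector:
  "columns3 p q r *v vector [x, y, z] = x *\<^sub>R p + y *\<^sub>R q + z *\<^sub>R r"
  by (simp add: columns3_def matrix_vector_mult_def sum_3 vec_eq_iff forall_3 vector_3)

lemma columns3_inj:
  assumes "det (columns3 p q r) \<noteq> 0"
    and "x *\<^sub>R p + y *\<^sub>R q + z *\<^sub>R r = x' *\<^sub>R p + y' *\<^sub>R q + z' *\<^sub>R r"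
  shows "x = x' \<and> y = y' \<and> z = z'"
proof -
  have "inj ((*v) (columns3 p q r))"
    using assms(1) by (intro inj_matrix_vector_mult) (simp add: invertible_det_nz)
  then have "(vector [x, y, z] :: real^3) = vector [x', y', z']"
    by (rule injD) (simp add: columns3_mult_vector assms(2))
  then show ?thesis by simp
qed

lemma convex_hull_4I:
  fixes v0 v1 v2 v3 :: "'a::real_vector"
  assumes "0 \<le> \<alpha>" "0 \<le> \<beta>" "0 \<le> \<gamma>" "\<alpha> + \<beta> + \<gamma> \<le> 1"
  shows "v1 + (\<alpha> *\<^sub>R (v2 - v1) + \<beta> *\<^sub>R (v3 - v1) + \<gamma> *\<^sub>R (v0 - v1)) \<in> convex hull {v0, v1, v2, v3}"
proof -
  let ?S = "convex hull {v0, v1, v2, v3}"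
  let ?c = "\<lambda>i::nat. [\<gamma>, 1 - \<alpha> - \<beta> - \<gamma>, \<alpha>, \<beta>] ! i"
  let ?v = "\<lambda>i::nat. [v0, v1, v2, v3] ! i"
  have "(\<Sum>i<4. ?c i *\<^sub>R ?v i) \<in> ?S"
  proof (rule convex_sum[OF _ convex_convex_hull])
    show "?v i \<in> ?S" if "i \<in> {..<4}" for i
      using less_4_cases[of i] that by (auto intro!: hull_inc)
    show "0 \<le> ?c i" if "i \<in> {..<4}" for i
      using less_4_cases[of i] that assms by auto
  qed (simp_all add: sum_lessThan_4)
  then show ?thesis by (simp add: sum_lessThan_4 algebra_simps)
qed

text \<open>The face opposite \<open>v0\<close> is an empty triangle, so a unimodular affine map
  sends \<open>v1\<close>, \<open>v2\<close>, \<open>v3\<close> to the base of \<open>T_abn\<close>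
  and \<open>v0\<close> to its apex. The last assumption on \<open>c\<close> says that
  \<open>N\<close> and the \<open>c i\<close> have no common factor; it makes \<open>g\<close> an
  integer.\<close>

lemma tetrahedron_balanced:
  fixes T :: "(real^3) set" and w v0 v1 v2 v3 :: "real^3" and n :: real
    and c :: "nat \<Rightarrow> int" and N :: int
  assumes T: "one_point_lattice_tetrahedron T" "w \<in> interior T" "w \<in> int_lattice"
    and v: "distinct [v0, v1, v2, v3]" "vertices T = {v0, v1, v2, v3}"
    and w: "of_int N *\<^sub>R w = of_int (c 0) *\<^sub>R v0 + of_int (c 1) *\<^sub>R v1
      + of_int (c 2) *\<^sub>R v2 + of_int (c 3) *\<^sub>R v3"
    and c: "\<And>i. i < 4 \<Longrightarrow> c i > 0" "N = (\<Sum>i<4. c i)"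
      "\<And>m. (\<And>i. i < 4 \<Longrightarrow> N dvd c i * m) \<Longrightarrow> N dvd m"
    and vol: "measure lebesgue T = n / 6" "n / of_int N > 1"
  obtains a b g where "balanced ((!) [1, a + b - 1, - a, - b]) c g N" "n = of_int (g * N)"
    "lattice_equiv (vertices T) (T_vertices a b (g * N))"
proof -
  define d e f where "d = v2 - v1" and "e = v3 - v1" and "f = v0 - v1"
  have "N > 0" unfolding c(2) by (rule sum_pos) (auto intro: c(1) simp: lessThan_empty_iff)
  have T_hull: "T = convex hull {v0, v1, v2, v3}"
    using T(1) simplex_vertices(1) v(2)
    unfolding one_point_lattice_tetrahedron_def lattice_tetrahedron_def by metis
  have lat: "v0 \<in> int_lattice" "v1 \<in> int_lattice" "v2 \<in> int_lattice" "v3 \<in> int_lattice"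
    using T(1) v(2) unfolding one_point_lattice_tetrahedron_def lattice_tetrahedron_def by auto
  then have lat': "d \<in> int_lattice" "e \<in> int_lattice" "f \<in> int_lattice"
    unfolding d_def e_def f_def by (auto intro: int_lattice_diff)
  have "measure lebesgue T = measure lborel T"
    unfolding T_hull by (intro measure_completion) (simp add: borel_compact compact_convex_hull finite_imp_compact)
  then have n: "n = \<bar>det (columns3 d e f)\<bar>"
    using vol(1) content_tetrahedron[OF v(1)] by (simp add: T_hull d_def e_def f_def)
  have "n > 0" using vol(2) \<open>N > 0\<close> by (simp add: field_simps)
  then have det: "det (columns3 d e f) \<noteq> 0" using n by auto
  have w': "w = v1 + ((of_int (c 2) / of_int N) *\<^sub>R d + (of_int (c 3) / of_int N) *\<^sub>R e
      + (of_int (c 0) / of_int N) *\<^sub>R f)"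
  proof -
    have N: "real_of_int N = of_int (c 0) + of_int (c 1) + of_int (c 2) + of_int (c 3)"
      unfolding c(2) sum_lessThan_4 by simp
    have "of_int N *\<^sub>R (w - v1) = of_int (c 2) *\<^sub>R d + of_int (c 3) *\<^sub>R e + of_int (c 0) *\<^sub>R f"
      unfolding scaleR_diff_right w unfolding N d_def e_def f_def by (simp add: algebra_simps)
    then have "w - v1 = (1 / of_int N) *\<^sub>R (of_int (c 2) *\<^sub>R d + of_int (c 3) *\<^sub>R e + of_int (c 0) *\<^sub>R f)"
      using \<open>N > 0\<close> by (metis divideR_right inverse_eq_divide less_irrefl of_int_eq_0_iff)
    then show ?thesis by (simp add: scaleR_add_right algebra_simps)
  qed
  \<comment> \<open>The five triples are the positions of \<open>v0\<close>, \<open>v1\<close>,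
    \<open>v2\<close>, \<open>v3\<close> and \<open>w\<close> relative to the origin
    \<open>v1\<close> and the edges \<open>d\<close>, \<open>e\<close>, \<open>f\<close>.\<close>
  have coords: "(\<alpha>, \<beta>, \<gamma>) \<in> {(0, 0, 1), (0, 0, 0), (1, 0, 0), (0, 1, 0),
      (of_int (c 2) / of_int N, of_int (c 3) / of_int N, of_int (c 0) / of_int N)}"
    if "0 \<le> \<alpha>" "0 \<le> \<beta>" "0 \<le> \<gamma>" "\<alpha> + \<beta> + \<gamma> \<le> 1" "\<alpha> *\<^sub>R d + \<beta> *\<^sub>R e + \<gamma> *\<^sub>R f \<in> int_lattice" for \<alpha> \<beta> \<gamma>
  proof -
    let ?p = "v1 + (\<alpha> *\<^sub>R d + \<beta> *\<^sub>R e + \<gamma> *\<^sub>R f)"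
    have "?p \<in> T" unfolding T_hull d_def e_def f_def using that by (intro convex_hull_4I)
    moreover have "?p \<in> int_lattice" using lat(2) that(5) by (rule int_lattice_add)
    ultimately have "?p \<in> {v0, v1, v2, v3} \<or> ?p = w" using one_point_cases[OF T] v(2) by blast
    moreover have "v0 = v1 + (0 *\<^sub>R d + 0 *\<^sub>R e + 1 *\<^sub>R f)" "v1 = v1 + (0 *\<^sub>R d + 0 *\<^sub>R e + 0 *\<^sub>R f)"
      "v2 = v1 + (1 *\<^sub>R d + 0 *\<^sub>R e + 0 *\<^sub>R f)" "v3 = v1 + (0 *\<^sub>R d + 1 *\<^sub>R e + 0 *\<^sub>R f)"
      by (simp_all add: d_def e_def f_def)
    ultimately obtain x y z where "(x, y, z) \<in> {(0, 0, 1), (0, 0, 0), (1, 0, 0), (0, 1, 0),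
      (of_int (c 2) / of_int N, of_int (c 3) / of_int N, of_int (c 0) / of_int N)}"
      "?p = v1 + (x *\<^sub>R d + y *\<^sub>R e + z *\<^sub>R f)"
      using w' by (smt (verit) insert_iff empty_iff)
    then show ?thesis using columns3_inj[OF det, of \<alpha> \<beta> \<gamma> x y z] by simp
  qed
  \<comment> \<open>The positive weight of \<open>w\<close> at \<open>v0\<close> keeps it off the
    plane \<gamma> = 0, so the face spanned by \<open>d\<close> and \<open>e\<close> is
    empty.\<close>
  have c0N: "of_int (c 0) / real_of_int N \<noteq> 0" using c(1)[of 0] \<open>N > 0\<close> by simp
  obtain M a b n' where M: "unimodular M" "n' > 0"
    "M *v d = vector [1, 0, 0]" "M *v e = vector [0, 1, 0]"
    "M *v f = vector [of_int a, of_int b, of_int n']" and n': "\<bar>det (columns3 d e f)\<bar> = of_int n'"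
  proof (rule empty_triangle_unimodular[OF lat' det])
    show "\<alpha> = 0 \<and> \<beta> = 0 \<or> \<alpha> = 1 \<and> \<beta> = 0 \<or> \<alpha> = 0 \<and> \<beta> = 1"
      if "0 \<le> \<alpha>" "0 \<le> \<beta>" "\<alpha> + \<beta> \<le> 1" "\<alpha> *\<^sub>R d + \<beta> *\<^sub>R e \<in> int_lattice" for \<alpha> \<beta>
      using coords[of \<alpha> \<beta> 0] that c0N by auto
  qed blast
  have M_comb: "M *v (\<alpha> *\<^sub>R d + \<beta> *\<^sub>R e + \<gamma> *\<^sub>R f)
      = vector [\<alpha> + \<gamma> * of_int a, \<beta> + \<gamma> * of_int b, \<gamma> * of_int n']" for \<alpha> \<beta> \<gamma>
    by (simp add: matrix_vector_right_distrib matrix_vector_mult_scaleR M vector3_scaleR vector3_add)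
  have "M *v (w - v1) \<in> int_lattice"
    using M(1) T(3) lat(2) by (auto simp: unimodular_def intro!: int_lattice_mult int_lattice_diff)
  then obtain x y z where Mw: "M *v (w - v1) = vector [of_int x, of_int y, of_int z]"
    using int_lattice_cases by blast
  have "w - v1 = (of_int (c 2) / of_int N) *\<^sub>R d + (of_int (c 3) / of_int N) *\<^sub>R e
      + (of_int (c 0) / of_int N) *\<^sub>R f" using w' by (metis add_diff_cancel_left')
  note Mw[unfolded this M_comb vector3_eq_iff]
  then have "real_of_int N * of_int x = of_int (c 2) + of_int (c 0) * of_int a"
    "real_of_int N * of_int y = of_int (c 3) + of_int (c 0) * of_int b"
    "real_of_int N * of_int z = of_int (c 0) * of_int n'"
    using \<open>N > 0\<close> by (simp_all add: field_simps)
  then have xyz: "N * x = c 2 + c 0 * a" "N * y = c 3 + c 0 * b" "N * z = c 0 * n'"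
    by (simp_all flip: of_int_mult of_int_add)
  \<comment> \<open>The height of \<open>w\<close> gives \<open>N dvd c 0 * n'\<close>; its other
    two coordinates and the sum of the \<open>c i\<close> carry this over to every
    \<open>c i\<close>.\<close>
  have "N dvd n'"
  proof (rule c(3))
    have 0: "N dvd c 0 * n'" by (metis dvd_triv_left xyz(3))
    have c23: "c 2 = N * x - c 0 * a" "c 3 = N * y - c 0 * b" using xyz(1,2) by simp_all
    have "c 2 * n' = N * (x * n') - a * (c 0 * n')" "c 3 * n' = N * (y * n') - b * (c 0 * n')"
      unfolding c23 by (simp_all add: algebra_simps)
    then have 2: "N dvd c 2 * n'" "N dvd c 3 * n'"
      using 0 by (simp_all add: dvd_diff)
    have "c 1 * n' = N * n' - c 0 * n' - c 2 * n' - c 3 * n'"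
      unfolding c(2) sum_lessThan_4 by (simp add: algebra_simps)
    then have 1: "N dvd c 1 * n'" using 0 2 by simp
    show "N dvd c i * n'" if "i < 4" for i
      using less_4_cases[OF that] 0 1 2 by auto
  qed
  then obtain g where g: "n' = g * N" by (metis dvdE mult.commute)
  have "g > 1" using vol(2) n n' g \<open>N > 0\<close> by simp
  show ?thesis
  proof (rule that[of a b g])
    show "n = of_int (g * N)" using n n' g by simp
    have "M *v v1 \<in> int_lattice" using M(1) lat(2) by (simp add: unimodular_def int_lattice_mult)
    then have "- (M *v v1) \<in> int_lattice" by (simp add: int_lattice_def)
    have "(\<lambda>v. M *v v + - (M *v v1)) ` vertices T = (\<lambda>v. M *v (v - v1)) ` vertices T"
      by (simp add: matrix_vector_mult_diff_distrib)
    also have "\<dots> = T_vertices a b (g * N)"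
      unfolding v(2) T_vertices_def g[symmetric] using M(3-5)[unfolded d_def e_def f_def]
      by (auto simp: vec_eq_iff forall_3 vector_3)
    finally have "(\<lambda>v. M *v v + - (M *v v1)) ` vertices T = T_vertices a b (g * N)" .
    with \<open>- (M *v v1) \<in> int_lattice\<close> show "lattice_equiv (vertices T) (T_vertices a b (g * N))"
      unfolding lattice_equiv_def using M(1) by blast
    show "balanced ((!) [1, a + b - 1, - a, - b]) c g N"
    proof (rule balancedI[OF \<open>g > 1\<close> c(1,2) xyz(1,2)])
      fix x y z
      assume *: "0 \<le> z" "0 \<le> g * N * x - a * z" "0 \<le> g * N * y - b * z"
        "z + (g * N * x - a * z) + (g * N * y - b * z) \<le> g * N"
      let ?\<alpha> = "real_of_int (n' * x - a * z) / of_int n'"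
      let ?\<beta> = "real_of_int (n' * y - b * z) / of_int n'"
      let ?\<gamma> = "real_of_int z / of_int n'"
      have "M *v (?\<alpha> *\<^sub>R d + ?\<beta> *\<^sub>R e + ?\<gamma> *\<^sub>R f) = vector [of_int x, of_int y, of_int z]"
        unfolding M_comb using \<open>n' > 0\<close> by (simp add: field_simps)
      then have "?\<alpha> *\<^sub>R d + ?\<beta> *\<^sub>R e + ?\<gamma> *\<^sub>R f \<in> int_lattice"
        using unimodular_int_lattice[OF M(1)] by simp
      moreover have "0 \<le> ?\<alpha>" "0 \<le> ?\<beta>" "0 \<le> ?\<gamma>"
        using *(1-3) \<open>n' > 0\<close> unfolding g[symmetric]
        by (intro divide_nonneg_nonneg; simp only: of_int_0_le_iff)+
      moreover have "?\<alpha> + ?\<beta> + ?\<gamma> \<le> 1"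
      proof -
        have "(n' * x - a * z) + (n' * y - b * z) + z \<le> n'"
          using *(4) unfolding g[symmetric] by linarith
        then have "real_of_int ((n' * x - a * z) + (n' * y - b * z) + z) \<le> of_int n'"
          by (simp only: of_int_le_iff)
        then show ?thesis
          using \<open>n' > 0\<close> unfolding add_divide_distrib[symmetric] of_int_add[symmetric]
          by (simp only: divide_le_eq_1_pos of_int_0_less_iff)
      qed
      ultimately have "?\<gamma> = 1 \<or> ?\<gamma> = 0 \<or> ?\<gamma> = of_int (c 0) / of_int N"
        using coords[of ?\<alpha> ?\<beta> ?\<gamma>] by auto
      moreover have "of_int (c 0) / of_int N = real_of_int (g * c 0) / of_int n'"
        using \<open>N > 0\<close> \<open>g > 1\<close> by (simp add: g)
      ultimately show "z = 0 \<or> z = g * N \<or> z = g * c 0"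
        using \<open>n' > 0\<close> unfolding g[symmetric] by (auto simp: field_simps simp flip: of_int_mult)
    qed
  qed
qed


section \<open>Arithmetic of the seven tuples and the conclusion\<close>

definition bary_numerators :: "nat \<Rightarrow> int list" where
  "bary_numerators l =
     [[1, 1, 1, 1], [1, 1, 1, 2], [1, 1, 2, 3], [2, 1, 3, 5], [1, 3, 4, 5], [2, 3, 5, 7],
      [3, 5, 4, 7]] ! (l - 1)"

lemma tuple_index_cases:
  "l \<in> {1..7} \<Longrightarrow> l = 1 \<or> l = 2 \<or> l = 3 \<or> l = 4 \<or> l = 5 \<or> l = 6 \<or> l = (7::nat)"
  by auto

lemma
  assumes "l \<in> {1..7}"
  shows bary_tuple_eq: "bary_tuple l = map (\<lambda>k. of_int k / bary_denom l) (bary_numerators l)"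
    and bary_numerators_sum: "int (bary_denom l) = (\<Sum>i<4. bary_numerators l ! i)"
    and length_bary_numerators: "length (bary_numerators l) = 4"
    and list_all_bary_numerators: "list_all ((<) 0) (bary_numerators l)"
  using tuple_index_cases[OF assms]
  by (elim disjE; simp add: bary_tuple_def bary_denom_def bary_numerators_def sum_lessThan_4)+

lemma bary_numerators_pos: "l \<in> {1..7} \<Longrightarrow> i < 4 \<Longrightarrow> bary_numerators l ! i > 0"
  using list_all_bary_numerators length_bary_numerators by (simp add: list_all_length)

text \<open>With \<open>c\<close> for the numerators, in every tuple one of \<open>c 0\<close>,
  \<open>c 1\<close>, \<open>c 1 - c 0\<close> and \<open>c 2 - c 0\<close> equals 1.\<close>

lemma bary_denom_dvd:
  assumes "l \<in> {1..7}" "\<And>i. i < 4 \<Longrightarrow> int (bary_denom l) dvd bary_numerators l ! i * m"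
  shows "int (bary_denom l) dvd m"
proof -
  let ?N = "int (bary_denom l)" and ?c = "\<lambda>i. bary_numerators l ! i"
  have "?N dvd ?c 0 * m" "?N dvd ?c 1 * m" "?N dvd (?c 1 - ?c 0) * m"
    "?N dvd (?c 2 - ?c 0) * m"
    using assms(2)[of 0] assms(2)[of 1] assms(2)[of 2]
    by (simp_all add: dvd_diff left_diff_distrib)
  then show ?thesis
    using tuple_index_cases[OF assms(1)] by (auto simp: bary_denom_def bary_numerators_def)
qed

lemma balanced_bary_numerators:
  assumes "balanced A ((!) (bary_numerators l)) g (int (bary_denom l))" "l \<in> {1..7}"
  shows "l = 1 \<and> g = 5 \<and> (A 1 mod 20, A 2 mod 20, A 3 mod 20) \<in> set
    [(9, 13, 17), (9, 17, 13), (13, 9, 17), (13, 17, 9), (17, 9, 13), (17, 13, 9)]"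
  using tuple_index_cases[OF assms(2)]
proof (elim disjE)
  assume "l = 1"
  with balanced.g_eq_5[OF assms(1)] show ?thesis by (simp add: bary_numerators_def)
next
  assume "l = 2"
  with balanced.False_1_1_1_2[OF assms(1)] show ?thesis by (simp add: bary_numerators_def)
next
  assume "l = 3"
  with balanced.False_1_1_2_3[OF assms(1)] show ?thesis by (simp add: bary_numerators_def)
next
  assume "l = 4"
  with balanced.False_2_1_3_5[OF assms(1)] show ?thesis by (simp add: bary_numerators_def)
next
  assume "l = 5"
  with balanced.False_1_3_4_5[OF assms(1)] show ?thesis by (simp add: bary_numerators_def)
next
  assume "l = 6"
  with balanced.False_2_3_5_7[OF assms(1)] show ?thesis by (simp add: bary_numerators_def)
next
  assume "l = 7"
  with balanced.False_3_5_4_7[OF assms(1)] show ?thesis by (simp add: bary_numerators_def)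
qed

theorem theorem14:
  fixes T :: "(real^3) set" and w :: "real^3" and n g :: real
    and vs :: "(real^3) list" and \<mu> :: "real list" and l :: nat
  assumes "one_point_lattice_tetrahedron T"
    and "measure lebesgue T = n / 6"
    and "w \<in> interior T" and "w \<in> int_lattice"
    and "distinct vs" and "set vs = vertices T"
    and "barycentric_coords vs w \<mu>"
    and "l \<in> {1..7}"
    and "mset \<mu> = mset (bary_tuple l)"
    and "g = n / real (bary_denom l)"
    and "g > 1"
  shows "l = 1 \<and> g = 5 \<and>
    equivalent T (T_abn 3 7 20) \<and>
    equivalent (T_abn 3 7 20) (T_abn 3 11 20) \<and>
    equivalent (T_abn 3 7 20) (T_abn 7 11 20)"
proof -
  let ?c = "(!) (bary_numerators l)" and ?N = "int (bary_denom l)"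
  obtain vs' where vs': "mset vs' = mset vs" "barycentric_coords vs' w (bary_tuple l)"
    using barycentric_coords_reorder[OF assms(7,9)] by blast
  have tuple: "bary_tuple l ! i = of_int (?c i) / of_int ?N" if "i < 4" for i
    using that by (simp add: bary_tuple_eq[OF assms(8)] length_bary_numerators[OF assms(8)])
  have "length vs' = 4"
    using vs'(2) bary_tuple_eq[OF assms(8)] length_bary_numerators[OF assms(8)]
    by (simp add: barycentric_coords_def)
  then obtain v0 v1 v2 v3 where v: "vs' = [v0, v1, v2, v3]"
    by (auto simp: length_Suc_conv numeral_eq_Suc)
  have "distinct vs'" "set vs' = vertices T"
    using vs'(1) assms(5,6) by (metis mset_eq_imp_distinct_iff) (metis vs'(1) assms(6) mset_eq_setD)
  then have v_vertices: "distinct [v0, v1, v2, v3]" "vertices T = {v0, v1, v2, v3}"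
    by (simp_all add: v)
  have N: "?N > 0"
    unfolding bary_numerators_sum[OF assms(8)]
    by (rule sum_pos) (use bary_numerators_pos[OF assms(8)] in \<open>auto simp: lessThan_empty_iff\<close>)
  have "w = (\<Sum>j<4. bary_tuple l ! j *\<^sub>R vs' ! j)"
    using vs'(2) \<open>length vs' = 4\<close> by (simp add: barycentric_coords_def)
  also have "\<dots> = (\<Sum>j<4. (of_int (?c j) / of_int ?N) *\<^sub>R vs' ! j)"
    using tuple by simp
  finally have "of_int ?N *\<^sub>R w = (\<Sum>j<4. of_int (?c j) *\<^sub>R vs' ! j)"
    using N by (simp add: scaleR_sum_right)
  then have w: "of_int ?N *\<^sub>R w = of_int (?c 0) *\<^sub>R v0 + of_int (?c 1) *\<^sub>R v1
      + of_int (?c 2) *\<^sub>R v2 + of_int (?c 3) *\<^sub>R v3"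
    by (simp add: sum_lessThan_4 v)
  obtain a b h where bal: "balanced ((!) [1, a + b - 1, - a, - b]) ?c h ?N" and
    n: "n = of_int (h * ?N)" and equiv: "lattice_equiv (vertices T) (T_vertices a b (h * ?N))"
  proof (rule tetrahedron_balanced[OF assms(1,3,4) v_vertices w, of n])
    show "measure lebesgue T = n / 6" by (rule assms)
    show "n / of_int ?N > 1" using assms(10,11) by simp
    show "?N dvd m" if "\<And>i. i < 4 \<Longrightarrow> ?N dvd ?c i * m" for m
      using bary_denom_dvd[OF assms(8) that] .
  qed (use bary_numerators_pos[OF assms(8)] bary_numerators_sum[OF assms(8)] in \<open>blast+\<close>)
  from balanced_bary_numerators[OF bal assms(8)]
  have l: "l = 1" "h = 5" and res: "((- a) mod 20, (- b) mod 20)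
      \<in> {(9, 13), (9, 17), (13, 9), (13, 17), (17, 9), (17, 13)}"
    by auto
  have N4: "?N = 4" by (simp add: l(1) bary_denom_def)
  \<comment> \<open>The residues found are those of \<open>- a\<close> and \<open>- b\<close>;
    complements in 20 turn 9, 13, 17 into 11, 7, 3.\<close>
  have neg: "x mod 20 = 20 - (- x) mod 20" if "(- x) mod 20 \<noteq> 0" for x :: int
    using that by (simp add: zmod_zminus1_eq_if split: if_splits)
  have "(- a) mod 20 \<noteq> 0" "(- b) mod 20 \<noteq> 0" using res by auto
  then have "(a mod 20, b mod 20) = (20 - (- a) mod 20, 20 - (- b) mod 20)"
    using neg by blast
  also have "\<dots> \<in> {(3, 7), (3, 11), (7, 3), (7, 11), (11, 3), (11, 7)}"
    using res by auto
  finally have "(a mod 20, b mod 20) \<in> {(3, 7), (3, 11), (7, 3), (7, 11), (11, 3), (11, 7)}" .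
  note T_vertices_equiv_3_7_20[OF this]
  moreover have "h * ?N = 20" by (simp add: l(2) N4)
  ultimately have "lattice_equiv (vertices T) (T_vertices 3 7 20)"
    using equiv lattice_equiv_trans by metis
  moreover have "lattice_tetrahedron T" 
    using assms(1) by (simp add: one_point_lattice_tetrahedron_def)
  moreover have "g = 5" using n assms(10) l N4 by (simp add: bary_denom_def)
  ultimately show ?thesis
    using l(1) T_vertices_3_7_20
    by (simp add: equivalent_iff vertices_T_abn lattice_tetrahedron_T_abn)
qed

end
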